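(* Consider the constrained multiobjective problem $\min_{x\in\Omega} f(x)=(f_1(x),\dots,f_m(x))^\top$ with $\Omega=\{x\in\mathcal X: c_j(x)\le 0,\ j\in\mathcal J\}\subset\mathbb R^n$ and constraint violation function $h$, and let DMulti-MADS (either the variant DMulti-MADS-TEB or the variant DMulti-MADS-PB described in the context) be run from the initial set $V^0$. Assume that (i) there is some $x^0\in V^0$ with $x^0\in\mathcal X$ and $f(x^0)$, $h(x^0)$ both finite, and (ii) all iterates considered by the algorithm lie in a bounded set. Suppose DMulti-MADS generates a refining subsequence $\{x_I^k\}_{k\in K}$ of infeasible frame centers, with $x_I^k\in I^k$, converging to a refining point $\hat x_I\in\mathcal X$. Assume that $h$ is Lipschitz continuous near $\hat x_I$ and $T^H_{\mathcal X}(\hat x_I)\neq\emptyset$. If the set of refining directions for $\hat x_I$ is dense in (the set of unit vectors of) $T^{Cl}_{\mathcal X}(\hat x_I)$, then $\hat x_I$ is a Clarke stationary point for $\min_{x\in\mathcal X}h(x)$, i.e. $h^o(\hat x_I;d)\ge0$ for every $d\in T^{Cl}_{\mathcal X}(\hat x_I)$.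
   Context: **Problem.** $\mathcal X\subseteq\mathbb R^n$; $f_i:\mathbb R^n\to\mathbb R\cup\{+\infty\}$ ($i=1,\dots,m$) and $c_j:\mathbb R^n\to\mathbb R\cup\{+\infty\}$ ($j\in\mathcal J$, finite) are given functions; $\Omega=\{x\in\mathcal X:c_j(x)\le0,\ j\in\mathcal J\}$. The constraint violation function is $h(x)=\sum_{j\in\mathcal J}(\max\{c_j(x),0\})^2$ if $x\in\mathcal X$ and $h(x)=+\infty$ otherwise; so $x\in\Omega$ iff $h(x)=0$. **Dominance.** For $x^1,x^2\in\Omega$: $x^1\prec_f x^2$ iff $f_i(x^1)\le f_i(x^2)$ for all $i$ with at least one strict inequality. For $x^1,x^2\in\mathcal X\setminus\Omega$: $x^1\prec_h x^2$ iff $f_i(x^1)\le f_i(x^2)$ for all $i$ and $h(x^1)\le h(x^2)$, with at least one strict inequality. Feasible and infeasible points are never compared. **Common structure.** $V^k\subset\mathcal X$ is the finite set of points evaluated by the start of iteration $k$; $V^0\ne\emptyset$ is given; $V^{k+1}$ is $V^k$ together with all points of $\mathcal X$ evaluated during iteration $k$. $F^k$ is the set of points of $V^k\cap\Omega$ not dominated ($\prec_f$) by another point of $V^k\cap\Omega$. $D=GZ\in\mathbb R^{n\times n_D}$ is a fixed matrix whose columns form a positive spanning set of $\mathbb R^n$, $G$ nonsingular, $Z$ an integer matrix. $\tau\in(0,1)\cap\mathbb Q$ and $w^+\in\mathbb N$ are fixed. Incumbents are stored as pairs $(x,\Delta)$ with frame size parameter $\Delta>0$ (initially $\Delta^0$):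 the list $L_F^k$ contains pairs with $x\in F^k$ and (PB only) the list $L_I^k$ contains pairs with $x\in I^k$ (defined below). At iteration $k$ one feasible and/or one infeasible pair is selected as frame center: $(x_F^k,\Delta_F^k)\in L_F^k$ and/or $(x_I^k,\Delta_I^k)\in L_I^k$. Set $\Delta^k=\Delta_F^k$ if $L_F^k\neq\emptyset$, else $\Delta^k=\Delta_I^k$; the mesh size parameter is $\delta^k=\min\{\Delta^k,(\Delta^k)^2\}$, and the mesh is $M^k=\bigcup_{x\in V^k}\{x+\delta^kDz:z\in\mathbb N^{n_D}\}$. The feasible center satisfies $\tau^{w^+}\Delta^k_{\max}\le\Delta_F^k\le\Delta^k_{\max}$, with $\Delta_{\max}^k=\max_{(x,\Delta)\in L_F^k}\Delta$. Each iteration has an optional search (evaluation of finitely many mesh points) and a poll. The poll evaluates points $x+\delta^kd\in M^k$, $d\in\mathbb D^k_\Delta$, around each selected frame center $x$, where $\mathbb D^k_\Delta$ is the finite set of poll directions used around that center (a positive spanning set for the primary center; possibly fewer directions around the secondary center when two centers are used), each direction being a nonnegative integer combination of columns of $D$, and $\delta^k\|d\|\le b\,\Delta^k$ for a constant $b$ independent of $k$. Points outside $\mathcal X$ are rejected. The iteration may stop early only once a success criterion (dominating or improving, below) is met; in an unsuccessful iteration all poll points lying in $\mathcal X$ are evaluated. **DMulti-MADS-PB.** $U^k$ is the set of $x\in V^k\setminus\Omega$ for which no $y\in V^k\setminus\Omega$ satisfies $y\prec_hx$. With a nonnegative threshold $h_{\max}^k$, $I^k$ is the set of points of $\{x\in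 U^k:0<h(x)\le h^k_{\max}\}$ whose vector $f(x)$ is Pareto-nondominated among the points of that set. If $L_F^k=\emptyset$, the infeasible center satisfies $\Delta_I^k\ge\Delta^k_{h_{\min}}$, where $(x^k_{h_{\min}},\Delta^k_{h_{\min}})\in\arg\min_{(x,\Delta)\in L_I^k}h(x)$. If both lists are nonempty, $x_I^k$ maximizes $\psi(x)$ over $L_I^k$, where $\psi(x)=\min_{(x^F,\Delta)\in L_F^k}\sum_i[f_i(x^F)-\min\{f_i(x),f_i(x^F)\}]$ if no $(x^F,\Delta)\in L_F^k$ has $f_i(x^F)\le f_i(x)$ for all $i$, and $\psi(x)=-\min_{(x^F,\Delta)\in L_F^k}\sum_i[f_i(x)-\min\{f_i(x),f_i(x^F)\}]$ otherwise. Iteration $k$ is *dominating* if some $x^t\in V^{k+1}$ satisfies $h(x^t)=0$ and $x^t\prec_fx_F^k$, or $h(x^t)>0$ and $x^t\prec_hx_I^k$; *improving* if not dominating and some $x^t\in V^{k+1}$ satisfies $0<h(x^t)<h(x_I^k)$ and $f_{i_0}(x_I^k)<f_{i_0}(x^t)$ for some $i_0$; *unsuccessful* otherwise (clauses concerning a nonexistent center are dropped), so that in an unsuccessful iteration every $x^t\in V^{k+1}$ satisfies: $h(x^t)=0$ and $x^t\nprec_fx_F^k$, or $h(x^t)=h(x_I^k)$ and $x^t\nprec_hx_I^k$, or $h(x^t)>h(x_I^k)$. New points get frame size $\tau^{-1}\Delta^k$ if they dominate a point of $F^k$ or $I^k$, or if they are feasible with $f_i\le\min_{F^k}f_i$ for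 all $i$ (one strict), or if $0<h\le\max_{I^k}h$ and $f_i\le\min_{I^k}f_i$ for all $i$ (one strict); otherwise they get $\Delta^k$. If the iteration is unsuccessful the frame size of each existing center becomes $\tau\Delta^k$. When $x_I^k$ exists, $h^{k+1}_{\max}$ equals $\max_{x^t\in V^{k+1}}\{h(x^t):h(x^t)<h(x_I^k)\}$ if the iteration is improving; else $h(x_I^k)$ if $h(x_I^k)=\max_{x\in I^k}h(x)$; else $\max_{x^t\in V^{k+1}}\{h(x^t):h(x_I^k)\le h(x^t)<\max_{x\in I^k}h(x)\}$. Then the lists are updated by adding new nondominated points and removing dominated points and points above the threshold. **DMulti-MADS-TEB.** If $V^0$ contains no feasible point, a first phase runs single-objective MADS on $\min_{x\in\mathcal X}h(x)$ (frame center $x_I^k$ = a point of $V^k$ with smallest $h$ value, $I^k$ being the set of such points; the iteration is successful iff a point with strictly smaller $h$ is found, otherwise unsuccessful and the frame size is multiplied by $\tau$). As soon as a feasible point is found, the second phase uses only $L_F^k$: $f$ is replaced by $(+\infty,\dots,+\infty)^\top$ outside $\Omega$, only feasible centers are used, the iteration is successful iff a generated feasible point dominates $x_F^k$, otherwise unsuccessful and the frame size of $x_F^k$ is multiplied by $\tau$. Thus this variant generates an infeasible refining subsequence only if no feasible point is ever found. **Refining notions.** Let $\mathbb U\subset\mathbb N$ be the set of indices of unsuccessful iterations. A subsequence $\{x^k\}_{k\in K}$ of frame centers around which the poll is executed, $K\subseteq\mathbb U$ infinite, is a *refining subsequence* if $\{\Delta^k\}_{k\in K}$ converges to $0$; its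 limit $\hat x$ is the *refining point*. A direction $d$ is a *refining direction* for $\hat x$ if there is an infinite $K'\subseteq K$ and $d^k\in\mathbb D^k_\Delta$ (poll directions used around $x^k$) with $x^k+\delta^kd^k\in\mathcal X$ for $k\in K'$ and $d=\lim_{k\in K'}d^k/\|d^k\|$. (So refining directions are unit vectors.) Density hypothesis: every unit vector of $T^{Cl}_{\mathcal X}(\hat x_I)$ is a limit of refining directions for $\hat x_I$. **Nonsmooth notions.** $d\in\mathbb R^n$ is a Clarke tangent vector to $\mathcal X$ at $x\in\overline{\mathcal X}$ if for every sequence $y^k\in\mathcal X$ converging to $x$ and every sequence of positive reals $t^k\to0$ there are $w^k\to d$ with $y^k+t^kw^k\in\mathcal X$; the set of these is the Clarke tangent cone $T^{Cl}_{\mathcal X}(x)$. The hypertangent cone is $T^H_{\mathcal X}(x)=\{d\in\mathbb R^n:\exists\epsilon>0,\ y+tw\in\mathcal X\ \text{for all } y\in\mathcal X\cap B_\epsilon(x),\ w\in B_\epsilon(d),\ 0<t<\epsilon\}$, with $B_\epsilon$ open balls. "$h$ Lipschitz continuous near $\hat x$" means $h$ is finite and Lipschitz on the intersection of $\mathcal X$ with some neighbourhood of $\hat x$. The Clarke–Jahn derivative is $h^o(x;d)=\limsup_{y\to x,\ y\in\mathcal X,\ t\searrow0,\ y+td\in\mathcal X}\frac{h(y+td)-h(y)}{t}$. *)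

theory Defs
  imports "HOL-Analysis.Analysis"
begin

section \<open>Nonsmooth notions\<close>

definition clarke_tangent_cone :: "'a::real_normed_vector set \<Rightarrow> 'a \<Rightarrow> 'a set" where
  "clarke_tangent_cone X x =
    {d. \<forall>(y::nat \<Rightarrow> 'a) (t::nat \<Rightarrow> real).
          (\<forall>k. y k \<in> X) \<longrightarrow> y \<longlonglongrightarrow> x \<longrightarrow> (\<forall>k. 0 < t k) \<longrightarrow> t \<longlonglongrightarrow> 0 \<longrightarrow>
          (\<exists>w. w \<longlonglongrightarrow> d \<and> (\<forall>k. y k + t k *\<^sub>R w k \<in> X))}"

definition hypertangent_cone :: "'a::real_normed_vector set \<Rightarrow> 'a \<Rightarrow> 'a set" where
  "hypertangent_cone X x =
    {d. \<exists>\<epsilon>>0. \<forall>y\<in>X \<inter> ball x \<epsilon>. \<forall>w\<in>ball d \<epsilon>. \<forall>t. 0 < t \<longrightarrow> t < \<epsilon> \<longrightarrow> y + t *\<^sub>R w \<in> X}"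

text \<open>The upper limit is taken over pairs \<open>(y, t)\<close> with \<open>y\<close> tending to \<open>x\<close> (the value \<open>y = x\<close>
  is allowed), \<open>t\<close> decreasing to 0, and both \<open>y\<close> and \<open>y + t d\<close> in \<open>X\<close>.\<close>

definition clarke_jahn_derivative ::
    "'a::real_normed_vector set \<Rightarrow> ('a \<Rightarrow> ereal) \<Rightarrow> 'a \<Rightarrow> 'a \<Rightarrow> ereal" where
  "clarke_jahn_derivative X g x d =
    Limsup (inf (nhds x \<times>\<^sub>F at_right 0) (principal {(y, t). y \<in> X \<and> y + t *\<^sub>R d \<in> X}))
      (\<lambda>(y, t). (g (y + t *\<^sub>R d) - g y) / ereal t)"

definition clarke_stationary :: "'a::real_normed_vector set \<Rightarrow> ('a \<Rightarrow> ereal) \<Rightarrow> 'a \<Rightarrow> bool" where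
  "clarke_stationary X g x \<longleftrightarrow> (\<forall>d\<in>clarke_tangent_cone X x. 0 \<le> clarke_jahn_derivative X g x d)"

definition lipschitz_near :: "'a::real_normed_vector set \<Rightarrow> ('a \<Rightarrow> ereal) \<Rightarrow> 'a \<Rightarrow> bool" where
  "lipschitz_near X g x \<longleftrightarrow>
    (\<exists>\<epsilon>>0. (\<forall>y\<in>X \<inter> ball x \<epsilon>. \<bar>g y\<bar> \<noteq> \<infinity>) \<and>
           (\<exists>L. L-lipschitz_on (X \<inter> ball x \<epsilon>) (\<lambda>y. real_of_ereal (g y))))"


section \<open>Constrained multiobjective problems and dominance\<close>

record ('n::finite, 'm::finite, 'j) problem =
  ground :: "(real^'n) set"
  obj :: "'m \<Rightarrow> real^'n \<Rightarrow> ereal"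
  cidx :: "'j set"
  con :: "'j \<Rightarrow> real^'n \<Rightarrow> ereal"

definition valid_problem :: "('n::finite, 'm::finite, 'j) problem \<Rightarrow> bool" where
  "valid_problem P \<longleftrightarrow>
    finite (cidx P) \<and> (\<forall>i x. obj P i x \<noteq> -\<infinity>) \<and> (\<forall>j\<in>cidx P. \<forall>x. con P j x \<noteq> -\<infinity>)"

definition feasible :: "('n::finite, 'm::finite, 'j) problem \<Rightarrow> (real^'n) set" where
  "feasible P = {x \<in> ground P. \<forall>j\<in>cidx P. con P j x \<le> 0}"

definition violation :: "('n::finite, 'm::finite, 'j) problem \<Rightarrow> real^'n \<Rightarrow> ereal" where
  "violation P x = (if x \<in> ground P then (\<Sum>j\<in>cidx P. (max (con P j x) 0)^2) else \<infinity>)"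

definition pareto_dom :: "('m \<Rightarrow> 'a \<Rightarrow> ereal) \<Rightarrow> 'a \<Rightarrow> 'a \<Rightarrow> bool" where
  "pareto_dom f x y \<longleftrightarrow> (\<forall>i. f i x \<le> f i y) \<and> (\<exists>i. f i x < f i y)"

definition dom_f :: "('n::finite, 'm::finite, 'j) problem \<Rightarrow> real^'n \<Rightarrow> real^'n \<Rightarrow> bool" where
  "dom_f P x y \<longleftrightarrow> x \<in> feasible P \<and> y \<in> feasible P \<and> pareto_dom (obj P) x y"

definition dom_h :: "('n::finite, 'm::finite, 'j) problem \<Rightarrow> real^'n \<Rightarrow> real^'n \<Rightarrow> bool" where
  "dom_h P x y \<longleftrightarrow>
    x \<in> ground P - feasible P \<and> y \<in> ground P - feasible P \<and>
    (\<forall>i. obj P i x \<le> obj P i y) \<and> violation P x \<le> violation P y \<and>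
    ((\<exists>i. obj P i x < obj P i y) \<or> violation P x < violation P y)"

text \<open>\<open>feas_front\<close>, \<open>inf_front\<close> and \<open>pb_incumbents\<close> are the sets $F^k$, $U^k$ and (progressive
  barrier) $I^k$ for evaluated set \<open>V\<close> and threshold \<open>\<eta>\<close>.\<close>

definition feas_front ::
    "('n::finite, 'm::finite, 'j) problem \<Rightarrow> (real^'n) set \<Rightarrow> (real^'n) set" where
  "feas_front P V = {x \<in> V \<inter> feasible P. \<not> (\<exists>y \<in> V \<inter> feasible P. dom_f P y x)}"

definition inf_front ::
    "('n::finite, 'm::finite, 'j) problem \<Rightarrow> (real^'n) set \<Rightarrow> (real^'n) set" where
  "inf_front P V = {x \<in> V - feasible P. \<not> (\<exists>y \<in> V - feasible P. dom_h P y x)}"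

definition pb_incumbents ::
    "('n::finite, 'm::finite, 'j) problem \<Rightarrow> (real^'n) set \<Rightarrow> ereal \<Rightarrow> (real^'n) set" where
  "pb_incumbents P V \<eta> =
    (let A = {x \<in> inf_front P V. 0 < violation P x \<and> violation P x \<le> \<eta>}
     in {x \<in> A. \<not> (\<exists>y\<in>A. pareto_dom (obj P) y x)})"

definition least_violation ::
    "('n::finite, 'm::finite, 'j) problem \<Rightarrow> (real^'n) set \<Rightarrow> (real^'n) set" where
  "least_violation P V = {x \<in> V. \<forall>y\<in>V. violation P x \<le> violation P y}"

text \<open>The problem whose objectives are $+\infty$ outside the feasible set.\<close>

definition extreme_barrier ::
    "('n::finite, 'm::finite, 'j) problem \<Rightarrow> ('n, 'm, 'j) problem" where
  "extreme_barrier P = P\<lparr>obj := (\<lambda>i x. if x \<in> feasible P then obj P i x else \<infinity>)\<rparr>"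


section \<open>Parameters and runs\<close>

record ('n::finite, 'd::finite) params =
  Gmat :: "real^'n^'n"
  Zmat :: "int^'d^'n"
  tau :: real
  wplus :: nat
  bconst :: real
  Delta0 :: real

definition Dmat :: "('n::finite, 'd::finite) params \<Rightarrow> real^'d^'n" where
  "Dmat A = Gmat A ** (\<chi> i j. real_of_int (Zmat A $ i $ j))"

definition positive_spanning :: "(real^'n) set \<Rightarrow> bool" where
  "positive_spanning S \<longleftrightarrow>
    finite S \<and> (\<forall>v. \<exists>a. (\<forall>s\<in>S. 0 \<le> a s) \<and> v = (\<Sum>s\<in>S. a s *\<^sub>R s))"

definition valid_params :: "('n::finite, 'd::finite) params \<Rightarrow> bool" where
  "valid_params A \<longleftrightarrow>
    invertible (Gmat A) \<and> positive_spanning (columns (Dmat A)) \<and>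
    0 < tau A \<and> tau A < 1 \<and> tau A \<in> \<rat> \<and> 0 < Delta0 A"

definition nat_comb :: "('n::finite, 'd::finite) params \<Rightarrow> nat^'d \<Rightarrow> real^'n" where
  "nat_comb A z = Dmat A *v (\<chi> j. real (z $ j))"

datatype variant = TEB | PB

text \<open>A run, as sequences indexed by the iteration number \<open>k\<close>:
  \<open>evald\<close> is $V^k$;
  \<open>psize k x\<close> is the frame size stored with the evaluated point \<open>x\<close>, i.e. the second component of
  the pair in which \<open>x\<close> occurs in a list;
  \<open>hmax\<close> is the threshold (progressive barrier only);
  \<open>fcenter\<close>, \<open>icenter\<close> are the selected feasible and infeasible frame centers;
  \<open>frame\<close> is $\Delta^k$;
  \<open>search_pts\<close> are the points evaluated in the search;
  \<open>fdirs\<close>, \<open>idirs\<close> are the poll directions around the feasible and the infeasible center;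
  \<open>polled\<close> are the poll points that were actually tried.\<close>

record ('n::finite) run =
  evald :: "nat \<Rightarrow> (real^'n) set"
  psize :: "nat \<Rightarrow> real^'n \<Rightarrow> real"
  hmax :: "nat \<Rightarrow> ereal"
  fcenter :: "nat \<Rightarrow> (real^'n) option"
  icenter :: "nat \<Rightarrow> (real^'n) option"
  frame :: "nat \<Rightarrow> real"
  search_pts :: "nat \<Rightarrow> (real^'n) set"
  fdirs :: "nat \<Rightarrow> (real^'n) set"
  idirs :: "nat \<Rightarrow> (real^'n) set"
  polled :: "nat \<Rightarrow> (real^'n) set"

definition list_F ::
    "('n::finite, 'm::finite, 'j) problem \<Rightarrow> 'n run \<Rightarrow> nat \<Rightarrow> ((real^'n) \<times> real) set" where
  "list_F P r k = (\<lambda>x. (x, psize r k x)) ` feas_front P (evald r k)"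

definition list_I ::
    "('n::finite, 'm::finite, 'j) problem \<Rightarrow> 'n run \<Rightarrow> nat \<Rightarrow> ((real^'n) \<times> real) set" where
  "list_I P r k = (\<lambda>x. (x, psize r k x)) ` pb_incumbents P (evald r k) (hmax r k)"

text \<open>The first phase of the two-phase variant lasts as long as no feasible point has been
  evaluated.\<close>

definition first_phase :: "('n::finite, 'm::finite, 'j) problem \<Rightarrow> 'n run \<Rightarrow> nat \<Rightarrow> bool" where
  "first_phase P r k \<longleftrightarrow> evald r k \<inter> feasible P = {}"

definition incumbents_I ::
    "variant \<Rightarrow> ('n::finite, 'm::finite, 'j) problem \<Rightarrow> 'n run \<Rightarrow> nat \<Rightarrow> (real^'n) set" where
  "incumbents_I v P r k =
    (case v of
       PB \<Rightarrow> pb_incumbents P (evald r k) (hmax r k)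
     | TEB \<Rightarrow> (if first_phase P r k then least_violation P (evald r k) else {}))"


subsection \<open>Mesh, search and poll\<close>

definition mesh_size :: "('n::finite) run \<Rightarrow> nat \<Rightarrow> real" where
  "mesh_size r k = min (frame r k) ((frame r k)^2)"

definition mesh :: "('n::finite, 'd::finite) params \<Rightarrow> 'n run \<Rightarrow> nat \<Rightarrow> (real^'n) set" where
  "mesh A r k = (\<Union>x\<in>evald r k. range (\<lambda>z. x + mesh_size r k *\<^sub>R nat_comb A z))"

definition poll_points :: "('n::finite) run \<Rightarrow> nat \<Rightarrow> (real^'n) set" where
  "poll_points r k =
    {x + mesh_size r k *\<^sub>R d | x d. fcenter r k = Some x \<and> d \<in> fdirs r k} \<union>
    {x + mesh_size r k *\<^sub>R d | x d. icenter r k = Some x \<and> d \<in> idirs r k}"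

definition admissible_dirs ::
    "('n::finite, 'd::finite) params \<Rightarrow> 'n run \<Rightarrow> nat \<Rightarrow> real^'n \<Rightarrow> (real^'n) set \<Rightarrow> bool" where
  "admissible_dirs A r k x S \<longleftrightarrow>
    finite S \<and>
    (\<forall>d\<in>S. d \<in> range (nat_comb A) \<and> x + mesh_size r k *\<^sub>R d \<in> mesh A r k \<and>
           mesh_size r k * norm d \<le> bconst A * frame r k)"

text \<open>Which of two centers is the primary one is left open.\<close>

definition iteration ::
    "('n::finite, 'm::finite, 'j) problem \<Rightarrow> ('n, 'd::finite) params \<Rightarrow> 'n run \<Rightarrow> bool \<Rightarrow> nat \<Rightarrow> bool"
  where
  "iteration P A r unsucc k \<longleftrightarrow>
    finite (search_pts r k) \<and> search_pts r k \<subseteq> mesh A r k \<and>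
    (\<forall>x. fcenter r k = Some x \<longrightarrow> admissible_dirs A r k x (fdirs r k)) \<and>
    (\<forall>x. icenter r k = Some x \<longrightarrow> admissible_dirs A r k x (idirs r k)) \<and>
    (fcenter r k \<noteq> None \<and> positive_spanning (fdirs r k) \<or>
     icenter r k \<noteq> None \<and> positive_spanning (idirs r k)) \<and>
    polled r k \<subseteq> poll_points r k \<and>
    (unsucc \<longrightarrow> poll_points r k \<inter> ground P \<subseteq> polled r k) \<and>
    evald r (Suc k) = evald r k \<union> ((search_pts r k \<union> polled r k) \<inter> ground P)"


subsection \<open>Success criteria\<close>

definition pb_dominating :: "('n::finite, 'm::finite, 'j) problem \<Rightarrow> 'n run \<Rightarrow> nat \<Rightarrow> bool" where
  "pb_dominating P r k \<longleftrightarrow>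
    (\<exists>x\<in>evald r (Suc k).
       (\<exists>y. fcenter r k = Some y \<and> violation P x = 0 \<and> dom_f P x y) \<or>
       (\<exists>y. icenter r k = Some y \<and> violation P x > 0 \<and> dom_h P x y))"

definition pb_improving :: "('n::finite, 'm::finite, 'j) problem \<Rightarrow> 'n run \<Rightarrow> nat \<Rightarrow> bool" where
  "pb_improving P r k \<longleftrightarrow>
    \<not> pb_dominating P r k \<and>
    (\<exists>x\<in>evald r (Suc k). \<exists>y. icenter r k = Some y \<and>
       0 < violation P x \<and> violation P x < violation P y \<and> (\<exists>i. obj P i y < obj P i x))"

definition teb_successful :: "('n::finite, 'm::finite, 'j) problem \<Rightarrow> 'n run \<Rightarrow> nat \<Rightarrow> bool" where
  "teb_successful P r k \<longleftrightarrow>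
    (if first_phase P r k
     then (\<exists>x\<in>evald r (Suc k). \<exists>y. icenter r k = Some y \<and> violation P x < violation P y)
     else (\<exists>x\<in>evald r (Suc k). \<exists>y. fcenter r k = Some y \<and> dom_f (extreme_barrier P) x y))"

definition unsuccessful ::
    "variant \<Rightarrow> ('n::finite, 'm::finite, 'j) problem \<Rightarrow> 'n run \<Rightarrow> nat \<Rightarrow> bool" where
  "unsuccessful v P r k \<longleftrightarrow>
    (case v of
       PB \<Rightarrow> \<not> pb_dominating P r k \<and> \<not> pb_improving P r k
     | TEB \<Rightarrow> \<not> teb_successful P r k)"


subsection \<open>Selection of the frame centers\<close>

definition select_feasible ::
    "('n::finite, 'm::finite, 'j) problem \<Rightarrow> ('n, 'd::finite) params \<Rightarrow> 'n run \<Rightarrow> nat \<Rightarrow> bool" where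
  "select_feasible P A r k \<longleftrightarrow>
    (\<exists>x \<Delta>. fcenter r k = Some x \<and> (x, \<Delta>) \<in> list_F P r k \<and> frame r k = \<Delta> \<and>
       tau A ^ wplus A * Max (snd ` list_F P r k) \<le> \<Delta> \<and> \<Delta> \<le> Max (snd ` list_F P r k))"

text \<open>\<open>gap a b\<close> is $a - \min\{b, a\}$, with value 0 (not $\infty - \infty$) when both are $\infty$.\<close>

definition gap :: "ereal \<Rightarrow> ereal \<Rightarrow> ereal" where
  "gap a b = (if a \<le> b then 0 else a - min b a)"

definition psi ::
    "('n::finite, 'm::finite, 'j) problem \<Rightarrow> 'n run \<Rightarrow> nat \<Rightarrow> real^'n \<Rightarrow> ereal" where
  "psi P r k x =
    (if \<not> (\<exists>(y, \<Delta>)\<in>list_F P r k. \<forall>i. obj P i y \<le> obj P i x)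
     then Min ((\<lambda>(y, \<Delta>). \<Sum>i\<in>UNIV. gap (obj P i y) (obj P i x)) ` list_F P r k)
     else - Min ((\<lambda>(y, \<Delta>). \<Sum>i\<in>UNIV. gap (obj P i x) (obj P i y)) ` list_F P r k))"

definition pb_select ::
    "('n::finite, 'm::finite, 'j) problem \<Rightarrow> ('n, 'd::finite) params \<Rightarrow> 'n run \<Rightarrow> nat \<Rightarrow> bool" where
  "pb_select P A r k \<longleftrightarrow>
    (\<forall>x. icenter r k = Some x \<longrightarrow> (x, psize r k x) \<in> list_I P r k) \<and>
    (if list_F P r k \<noteq> {}
     then select_feasible P A r k \<and>
          (\<forall>x. icenter r k = Some x \<longrightarrow> (\<forall>(y, \<Delta>)\<in>list_I P r k. psi P r k y \<le> psi P r k x))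
     else fcenter r k = None \<and>
          (\<exists>x. icenter r k = Some x \<and> frame r k = psize r k x \<and>
             (\<exists>(y, \<Delta>)\<in>list_I P r k.
                (\<forall>(z, \<Delta>')\<in>list_I P r k. violation P y \<le> violation P z) \<and> \<Delta> \<le> psize r k x)))"


subsection \<open>Updates\<close>

text \<open>For empty \<open>B\<close> the infimum is $\infty$.\<close>

definition below_min :: "('m \<Rightarrow> 'a \<Rightarrow> ereal) \<Rightarrow> 'a \<Rightarrow> 'a set \<Rightarrow> bool" where
  "below_min f x B \<longleftrightarrow>
    (\<forall>i. f i x \<le> (INF y\<in>B. f i y)) \<and> (\<exists>i. f i x < (INF y\<in>B. f i y))"

definition new_size ::
    "('n::finite, 'm::finite, 'j) problem \<Rightarrow> real \<Rightarrow> (real^'n) set \<Rightarrow> (real^'n) set \<Rightarrow> real \<Rightarrow> real^'n \<Rightarrow> real"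
  where
  "new_size P \<tau> F I \<Delta> x =
    (if (\<exists>y\<in>F. dom_f P x y) \<or> (\<exists>y\<in>I. dom_h P x y) \<or>
        (x \<in> feasible P \<and> below_min (obj P) x F) \<or>
        (0 < violation P x \<and> violation P x \<le> (SUP y\<in>I. violation P y) \<and> below_min (obj P) x I)
     then inverse \<tau> * \<Delta> else \<Delta>)"

definition size_update ::
    "variant \<Rightarrow> ('n::finite, 'm::finite, 'j) problem \<Rightarrow> ('n, 'd::finite) params \<Rightarrow> 'n run \<Rightarrow> nat \<Rightarrow>
     real^'n \<Rightarrow> bool" where
  "size_update v P A r k x \<longleftrightarrow>
    psize r (Suc k) x =
      (if x \<notin> evald r k
       then new_size (case v of PB \<Rightarrow> P | TEB \<Rightarrow> extreme_barrier P) (tau A)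
              (feas_front P (evald r k)) (incumbents_I v P r k) (frame r k) x
       else if unsuccessful v P r k \<and> (fcenter r k = Some x \<or> icenter r k = Some x)
       then tau A * frame r k
       else psize r k x)"

definition hmax_update :: "('n::finite, 'm::finite, 'j) problem \<Rightarrow> 'n run \<Rightarrow> nat \<Rightarrow> bool" where
  "hmax_update P r k \<longleftrightarrow>
    hmax r (Suc k) =
      (case icenter r k of
         None \<Rightarrow> hmax r k
       | Some x \<Rightarrow>
          (let h = violation P;
               V' = evald r (Suc k);
               m = Max (h ` pb_incumbents P (evald r k) (hmax r k))
           in if pb_improving P r k then Max {h y | y. y \<in> V' \<and> h y < h x}
              else if h x = m then h x
              else Max {h y | y. y \<in> V' \<and> h x \<le> h y \<and> h y < m}))"


subsection \<open>Runs of the two variants\<close>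

definition pb_step ::
    "('n::finite, 'm::finite, 'j) problem \<Rightarrow> ('n, 'd::finite) params \<Rightarrow> 'n run \<Rightarrow> nat \<Rightarrow> bool" where
  "pb_step P A r k \<longleftrightarrow>
    pb_select P A r k \<and>
    iteration P A r (unsuccessful PB P r k) k \<and>
    (\<forall>x\<in>evald r (Suc k). size_update PB P A r k x) \<and>
    0 \<le> hmax r k \<and> hmax_update P r k"

text \<open>In the first phase there is a single frame size, \<open>frame\<close>. A successful first-phase iteration
  keeps it or increases it; the frame sizes with which the points found in the first phase enter
  the second phase are positive but otherwise arbitrary.\<close>

definition teb_step ::
    "('n::finite, 'm::finite, 'j) problem \<Rightarrow> ('n, 'd::finite) params \<Rightarrow> 'n run \<Rightarrow> nat \<Rightarrow> bool" where
  "teb_step P A r k \<longleftrightarrow>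
    iteration P A r (unsuccessful TEB P r k) k \<and>
    (if first_phase P r k
     then fcenter r k = None \<and>
          (\<exists>x. icenter r k = Some x \<and> x \<in> least_violation P (evald r k)) \<and>
          (k = 0 \<longrightarrow> frame r k = Delta0 A) \<and>
          (if first_phase P r (Suc k)
           then (if unsuccessful TEB P r k
                 then frame r (Suc k) = tau A * frame r k
                 else frame r (Suc k) \<in> {frame r k, inverse (tau A) * frame r k})
           else (\<forall>x\<in>evald r (Suc k). 0 < psize r (Suc k) x))
     else icenter r k = None \<and>
          select_feasible (extreme_barrier P) A r k \<and>
          (\<forall>x\<in>evald r (Suc k). size_update TEB P A r k x))"

definition dmulti_mads_run ::
    "variant \<Rightarrow> ('n::finite, 'm::finite, 'j) problem \<Rightarrow> ('n, 'd::finite) params \<Rightarrow> (real^'n) set \<Rightarrow>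
     'n run \<Rightarrow> bool" where
  "dmulti_mads_run v P A V0 r \<longleftrightarrow>
    finite V0 \<and> V0 \<noteq> {} \<and> V0 \<subseteq> ground P \<and> evald r 0 = V0 \<and>
    (\<forall>x\<in>V0. psize r 0 x = Delta0 A) \<and>
    (\<forall>k. 0 < frame r k) \<and>
    (\<forall>k. case v of PB \<Rightarrow> pb_step P A r k | TEB \<Rightarrow> teb_step P A r k)"


section \<open>Refining subsequences of infeasible frame centers\<close>

abbreviation along :: "nat set \<Rightarrow> nat filter" where
  "along K \<equiv> inf sequentially (principal K)"

definition infeasible_refining_subsequence ::
    "variant \<Rightarrow> ('n::finite, 'm::finite, 'j) problem \<Rightarrow> 'n run \<Rightarrow> nat set \<Rightarrow> (nat \<Rightarrow> real^'n) \<Rightarrow>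
     real^'n \<Rightarrow> bool" where
  "infeasible_refining_subsequence v P r K x xhat \<longleftrightarrow>
    infinite K \<and>
    (\<forall>k\<in>K. unsuccessful v P r k \<and> icenter r k = Some (x k)) \<and>
    (frame r \<longlongrightarrow> 0) (along K) \<and> (x \<longlongrightarrow> xhat) (along K)"

text \<open>The zero vector, which the mesh does not exclude as a poll direction, cannot be normalized.\<close>

definition infeasible_refining_directions ::
    "('n::finite, 'm::finite, 'j) problem \<Rightarrow> 'n run \<Rightarrow> nat set \<Rightarrow> (nat \<Rightarrow> real^'n) \<Rightarrow> (real^'n) set"
  where
  "infeasible_refining_directions P r K x =
    {u. \<exists>K' d. K' \<subseteq> K \<and> infinite K' \<and>
          (\<forall>k\<in>K'. d k \<in> idirs r k \<and> d k \<noteq> 0 \<and> x k + mesh_size r k *\<^sub>R d k \<in> ground P) \<and>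
          ((\<lambda>k. d k /\<^sub>R norm (d k)) \<longlongrightarrow> u) (along K')}"

end

theory Submission
  imports Defs
begin

text \<open>
  At an unsuccessful iteration every evaluated poll point around the infeasible center \<open>x\<close> is either
  feasible or has violation at least \<open>h x\<close>. If \<open>h\<close> vanishes at the refining point, that
  point is a global minimizer; otherwise feasible poll points are eventually excluded, so \<open>h\<close> does
  not decrease along the poll steps.  In both cases each Clarke tangent direction \<open>d\<close> is approached
  by steps \<open>x + t w\<close> with \<open>w\<close> close to \<open>d\<close> along which \<open>h\<close> does not decrease. Shifting the base
  point of such a step by \<open>\<kappa> t w0\<close>, where \<open>w0\<close> is a hypertangent direction and \<open>\<kappa>\<close> is small,
  allows \<open>w\<close> to be replaced by \<open>d\<close> itself without leaving the ground set, at the cost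
  of a Lipschitz error of order \<open>\<kappa> t\<close>.
\<close>

section \<open>From nearly \<open>d\<close>-directed steps to the Clarke-Jahn derivative along
  \<open>d\<close>\<close>

lemma clarke_jahn_derivative_nonneg:
  fixes X :: "'a::real_normed_vector set"
  assumes lip: "lipschitz_near X g xhat"
    and hyp: "hypertangent_cone X xhat \<noteq> {}"
    and nondecreasing: "\<And>e. 0 < e \<Longrightarrow> \<exists>x t w. x \<in> X \<and> dist x xhat < e \<and> 0 < t \<and> t < e \<and> dist w d < e \<and>
      x + t *\<^sub>R w \<in> X \<and> g x \<le> g (x + t *\<^sub>R w)"
  shows "0 \<le> clarke_jahn_derivative X g xhat d"
proof (rule ccontr)
  let ?F = "inf (nhds xhat \<times>\<^sub>F at_right 0) (principal {(y, t). y \<in> X \<and> y + t *\<^sub>R d \<in> X})"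
  let ?q = "\<lambda>(y, t). (g (y + t *\<^sub>R d) - g y) / ereal t"
  assume "\<not> ?thesis"
  then have "Limsup ?F ?q < 0" by (simp add: clarke_jahn_derivative_def)
  \<comment> \<open>Strict negativity leaves room for a real bound: all difference quotients along
    \<open>d\<close> between points of \<open>X\<close>, for pairs close enough to
    \<open>(xhat, 0)\<close>, lie below \<open>- c\<close>. The pair \<open>(p, t)\<close> built
    below violates this.\<close>
  then obtain b where b: "Limsup ?F ?q < ereal b" "ereal b < 0" using ereal_dense2 by blast
  define c where "c = - b"
  have c: "0 < c" using b(2) by (simp add: c_def)
  have "\<forall>\<^sub>F p in ?F. ?q p < ereal (- c)"
    using Limsup_lessD[OF b(1)] by (simp add: c_def)
  then have "\<forall>\<^sub>F p in nhds xhat \<times>\<^sub>F at_right 0.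
      p \<in> {(y, t). y \<in> X \<and> y + t *\<^sub>R d \<in> X} \<longrightarrow> ?q p < ereal (- c)"
    by (simp add: eventually_inf_principal)
  then have "\<exists>Pf Pg. eventually Pf (nhds xhat) \<and> eventually Pg (at_right (0::real)) \<and>
      (\<forall>y t. Pf y \<longrightarrow> Pg t \<longrightarrow> y \<in> X \<and> y + t *\<^sub>R d \<in> X \<longrightarrow> ?q (y, t) < ereal (- c))"
    unfolding eventually_prod_filter by simp
  then obtain Pf Pg where Pf: "eventually Pf (nhds xhat)" and Pg: "eventually Pg (at_right (0::real))"
    and PQ: "\<And>y t. Pf y \<Longrightarrow> Pg t \<Longrightarrow> y \<in> X \<Longrightarrow> y + t *\<^sub>R d \<in> X \<Longrightarrow> ?q (y, t) < ereal (- c)"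
    by blast
  obtain \<rho> L where \<rho>: "0 < \<rho>" and fin: "\<And>y. y \<in> X \<Longrightarrow> dist y xhat < \<rho> \<Longrightarrow> \<bar>g y\<bar> \<noteq> \<infinity>"
    and L: "L-lipschitz_on (X \<inter> ball xhat \<rho>) (\<lambda>y. real_of_ereal (g y))"
    using lip unfolding lipschitz_near_def by (auto simp: dist_commute)
  have L0: "0 \<le> L" using L by (rule lipschitz_on_nonneg)
  obtain w0 \<epsilon> where \<epsilon>: "0 < \<epsilon>" and
    ht: "\<And>y w t. y \<in> X \<Longrightarrow> dist y xhat < \<epsilon> \<Longrightarrow> dist w w0 < \<epsilon> \<Longrightarrow> 0 < t \<Longrightarrow> t < \<epsilon> \<Longrightarrow> y + t *\<^sub>R w \<in> X"
  proof -
    obtain w0 \<epsilon> where "0 < \<epsilon>"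
      "\<forall>y\<in>X \<inter> ball xhat \<epsilon>. \<forall>w\<in>ball w0 \<epsilon>. \<forall>t. 0 < t \<longrightarrow> t < \<epsilon> \<longrightarrow> y + t *\<^sub>R w \<in> X"
      using hyp unfolding hypertangent_cone_def by blast
    then show thesis by (intro that[of \<epsilon> w0]) (auto simp: dist_commute)
  qed
  define N where "N = norm w0"
  have N0: "0 \<le> N" by (simp add: N_def)
  \<comment> \<open>Passing from \<open>x\<close> to \<open>p\<close> costs at most
    \<open>L * \<kappa> * N\<close> per unit of \<open>t\<close>, passing from \<open>z\<close> to
    \<open>q\<close> at most \<open>L * \<kappa> * (N + \<epsilon>)\<close>. This
    \<open>\<kappa>\<close> keeps the sum below \<open>c\<close>; the \<open>+ 1\<close> covers a
    vanishing product in the denominator.\<close>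
  define \<kappa> where "\<kappa> = c / (L * (2 * N + \<epsilon>) + 1)"
  have den: "0 < L * (2 * N + \<epsilon>) + 1" using L0 N0 \<epsilon> by (simp add: add_nonneg_pos)
  have \<kappa>: "0 < \<kappa>" "L * (2 * N + \<epsilon>) * \<kappa> < c"
    using c den by (auto simp: \<kappa>_def field_simps)
  obtain e1 where e1: "0 < e1" "\<And>y. dist y xhat < e1 \<Longrightarrow> Pf y"
    using Pf by (auto simp: eventually_nhds_metric)
  obtain e2 where e2: "0 < e2" "\<And>t. 0 < t \<Longrightarrow> t < e2 \<Longrightarrow> Pg t"
    using Pg by (auto simp: eventually_at_right_field)
  define m where "m = Min {e1, e2, \<rho>, \<epsilon>}"
  have m: "0 < m" "m \<le> e1" "m \<le> e2" "m \<le> \<rho>" "m \<le> \<epsilon>"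
    using e1(1) e2(1) \<rho> \<epsilon> by (auto simp: m_def)
  \<comment> \<open>\<open>t * M\<close> dominates the displacements of \<open>z\<close>,
    \<open>p\<close> and \<open>q\<close> from \<open>x\<close>, and also \<open>s\<close>. Once it
    is below \<open>m / 2\<close>, all these points lie within \<open>m\<close> of
    \<open>xhat\<close>, where every local property is available.\<close>
  define M where "M = norm d + \<kappa> * \<epsilon> + \<kappa> * N + \<kappa> + 1"
  have Mparts: "0 \<le> norm d" "0 \<le> \<kappa> * \<epsilon>" "0 \<le> \<kappa> * N" using \<kappa> \<epsilon> N0 by auto
  then have M1: "1 \<le> M" using \<kappa> by (simp add: M_def)
  \<comment> \<open>The first bound gives \<open>t * M < m / 2\<close>, the second makes
    \<open>w\<close> close enough to \<open>d\<close> on the scale of \<open>\<kappa>\<close>, the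
    third places \<open>x\<close> itself.\<close>
  define e where "e = Min {m / (2 * M), \<kappa> * \<epsilon>, m / 2}"
  have e: "0 < e" "e \<le> m / (2 * M)" "e \<le> \<kappa> * \<epsilon>" "e \<le> m / 2"
    using m M1 \<kappa> \<epsilon> by (auto simp: e_def)
  obtain x t w where x: "x \<in> X" "dist x xhat < e" and t: "0 < t" "t < e" and w: "dist w d < e"
    and z: "x + t *\<^sub>R w \<in> X" and incr: "g x \<le> g (x + t *\<^sub>R w)"
    using nondecreasing[OF e(1)] by blast
  have tM: "t * M < m / 2"
  proof -
    have "t * M < m / (2 * M) * M" using t e M1 by (intro mult_strict_right_mono) auto
    then show ?thesis using M1 by simp
  qed
  have tM_le: "a \<le> M \<Longrightarrow> t * a < m / 2" for a
    using tM t(1) by (meson le_less_trans mult_left_mono less_imp_le)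
  define s where "s = \<kappa> * t"
  have s: "0 < s" using \<kappa> t by (simp add: s_def)
  have sm: "s < m / 2" using tM_le[of \<kappa>] Mparts by (simp add: M_def s_def mult.commute)
  have wd: "norm (d - w) < \<kappa> * \<epsilon>" using w e by (simp add: dist_norm norm_minus_commute)
  define p where "p = x + s *\<^sub>R w0"
  define z where "z = x + t *\<^sub>R w"
  define q where "q = p + t *\<^sub>R d"
  have near: "dist (x + v) xhat < m" if "norm v < m / 2" for v
  proof -
    have "dist (x + v) xhat \<le> norm v + dist x xhat"
      using norm_triangle_ineq[of v "x - xhat"] by (simp add: dist_norm algebra_simps)
    then show ?thesis using that x(2) e(4) by linarith
  qed
  have xm: "dist x xhat < m" using near[of 0] m by simp
  have nw: "norm w \<le> norm d + \<kappa> * \<epsilon>"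
    using norm_triangle_ineq4[of d "d - w"] wd by simp
  have zm: "dist z xhat < m"
    unfolding z_def using t(1) tM_le[of "norm w"] nw Mparts \<kappa>(1)
    by (intro near) (simp add: M_def)
  have pm: "dist p xhat < m"
    unfolding p_def using s t(1) tM_le[of "\<kappa> * N"] Mparts \<kappa>(1)
    by (intro near) (simp add: M_def s_def N_def ac_simps)
  have qm: "dist q xhat < m"
  proof -
    have "norm (s *\<^sub>R w0 + t *\<^sub>R d) \<le> s * N + t * norm d"
      using norm_triangle_ineq[of "s *\<^sub>R w0" "t *\<^sub>R d"] s t by (simp add: N_def)
    also have "\<dots> = t * (\<kappa> * N + norm d)" by (simp add: s_def algebra_simps)
    also have "\<dots> < m / 2" using Mparts \<kappa>(1) by (intro tM_le) (simp add: M_def)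
    finally show ?thesis using near[of "s *\<^sub>R w0 + t *\<^sub>R d"] by (simp add: q_def p_def add.assoc)
  qed
  have zX: "z \<in> X" using z by (simp add: z_def)
  have pX: "p \<in> X"
    unfolding p_def using x(1) xm m s sm \<epsilon> by (intro ht) auto
  \<comment> \<open>Since \<open>s / \<kappa> = t\<close>, the point \<open>q\<close> is also
    reached from \<open>z\<close> by a step of length \<open>s\<close>. Its direction is within
    \<open>\<epsilon>\<close> of \<open>w0\<close>, so the hypertangent property keeps
    \<open>q\<close> in \<open>X\<close>.\<close>
  have qz: "q = z + s *\<^sub>R (w0 + (1 / \<kappa>) *\<^sub>R (d - w))"
    using \<kappa>(1) by (simp add: q_def p_def z_def s_def algebra_simps)
  have qX: "q \<in> X"
    unfolding qz
  proof (rule ht)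
    show "dist (w0 + (1 / \<kappa>) *\<^sub>R (d - w)) w0 < \<epsilon>"
      using wd \<kappa>(1) by (simp add: dist_norm pos_divide_less_eq mult.commute)
  qed (use zX zm m s sm in auto)
  define G where "G = (\<lambda>y. real_of_ereal (g y))"
  have gG: "g y = ereal (G y)" if "y \<in> X" "dist y xhat < m" for y
    using fin[of y] that m by (simp add: G_def ereal_real')
  have lipG: "\<bar>G y - G y'\<bar> \<le> L * norm (y - y')"
    if "y \<in> X" "dist y xhat < m" "y' \<in> X" "dist y' xhat < m" for y y'
    using lipschitz_onD[OF L, of y y'] that m by (simp add: G_def dist_norm norm_minus_commute)
  \<comment> \<open>\<open>G q - G p\<close> splits into \<open>G q - G z\<close>,
    \<open>G z - G x\<close> and \<open>G x - G p\<close>; the middle term is nonnegative and the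
    outer two are Lipschitz errors.\<close>
  have "G x \<le> G z" using incr gG[OF x(1) xm] gG[OF zX zm] by (simp add: z_def)
  moreover have "\<bar>G q - G z\<bar> \<le> L * (t * (\<kappa> * N + \<kappa> * \<epsilon>))"
  proof -
    have "norm (q - z) \<le> norm (s *\<^sub>R w0) + norm (t *\<^sub>R (d - w))"
      using norm_triangle_ineq[of "s *\<^sub>R w0" "t *\<^sub>R (d - w)"]
      by (simp add: q_def p_def z_def algebra_simps)
    also have "\<dots> \<le> s * N + t * (\<kappa> * \<epsilon>)"
      using s t wd by (simp add: N_def)
    also have "\<dots> = t * (\<kappa> * N + \<kappa> * \<epsilon>)" by (simp add: s_def algebra_simps)
    finally show ?thesis
      using lipG[OF qX qm zX zm] L0 by (meson mult_left_mono order_trans)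
  qed
  moreover have "\<bar>G p - G x\<bar> \<le> L * (t * (\<kappa> * N))"
    using lipG[OF pX pm x(1) xm] s by (simp add: p_def s_def N_def ac_simps)
  ultimately have "G q - G p \<ge> - (t * (L * (2 * N + \<epsilon>) * \<kappa>))"
    by (simp add: algebra_simps abs_le_iff)
  moreover have "t * (L * (2 * N + \<epsilon>) * \<kappa>) < t * c"
    using \<kappa>(2) t by simp
  ultimately have "- c < (G q - G p) / t"
    using t by (simp add: field_simps)
  then have "ereal (- c) < ?q (p, t)"
    using t gG[OF qX qm] gG[OF pX pm] by (simp add: q_def)
  moreover have "?q (p, t) < ereal (- c)"
  proof (rule PQ)
    have "t < m / 2" using t e by simp
    then show "Pg t" using e2(2) t m by auto
  qed (use e1 pm m pX qX in \<open>auto simp: q_def\<close>)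
  ultimately show False by simp
qed

section \<open>The violation function along a run\<close>

lemma violation_nonneg: "0 \<le> violation P x"
  by (auto simp: violation_def intro!: sum_nonneg)

lemma violation_eq_0_if_feasible: "x \<in> feasible P \<Longrightarrow> violation P x = 0"
  by (auto simp: violation_def feasible_def max_def power2_eq_square intro!: sum.neutral)

lemma iteration_of_run:
  assumes "dmulti_mads_run v P A V0 r"
  shows "iteration P A r (unsuccessful v P r k) k"
  using assms unfolding dmulti_mads_run_def pb_step_def teb_step_def
  by (cases v) auto

lemma evald_subset_ground:
  assumes "dmulti_mads_run v P A V0 r"
  shows "evald r k \<subseteq> ground P"
proof (induction k)
  case 0
  then show ?case using assms by (simp add: dmulti_mads_run_def)
next
  case (Suc k)
  then show ?case using iteration_of_run[OF assms, of k] by (auto simp: iteration_def)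
qed

text \<open>For \<open>TEB\<close>, an infeasible incumbent exists only in the first phase, where
  any decrease of the violation is a success. For \<open>PB\<close>, an infeasible point of smaller
  violation makes the iteration improving if some objective is worse than at the center, and
  dominating otherwise.\<close>

lemma violation_ge_infeasible_center:
  assumes run: "dmulti_mads_run v P A V0 r"
    and unsucc: "unsuccessful v P r k"
    and center: "icenter r k = Some x" "x \<in> incumbents_I v P r k"
    and y: "y \<in> evald r (Suc k)" "0 < violation P y"
  shows "violation P x \<le> violation P y"
proof (cases v)
  case TEB
  then have "first_phase P r k"
    using center(2) by (auto simp: incumbents_I_def split: if_splits)
  then show ?thesis
    using TEB unsucc center(1) y(1) by (force simp: unsuccessful_def teb_successful_def)
next
  case PB
  show ?thesis
  proof (rule ccontr)
    assume "\<not> ?thesis"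
    then have less: "violation P y < violation P x" by simp
    have "x \<in> evald r k - feasible P"
      using center(2) PB by (auto simp: incumbents_I_def pb_incumbents_def inf_front_def Let_def)
    then have "x \<in> ground P - feasible P" using evald_subset_ground[OF run] by blast
    moreover have "y \<in> ground P - feasible P"
      using evald_subset_ground[OF run] y violation_eq_0_if_feasible by fastforce
    moreover have nd: "\<not> pb_dominating P r k" and ni: "\<not> pb_improving P r k"
      using unsucc PB by (auto simp: unsuccessful_def)
    moreover have "obj P i y \<le> obj P i x" for i
    proof (rule ccontr)
      assume "\<not> ?thesis"
      then have "\<exists>i. obj P i x < obj P i y" by (auto simp: not_le)
      then have "pb_improving P r k"
        unfolding pb_improving_def using nd less center(1) y by (intro conjI bexI[of _ y] exI[of _ x]) auto
      then show False using ni by contradiction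
    qed
    ultimately have "dom_h P y x" using less by (simp add: dom_h_def)
    then have "pb_dominating P r k"
      unfolding pb_dominating_def using center(1) y by (intro bexI[of _ y] disjI2 exI[of _ x]) auto
    then show False using nd by contradiction
  qed
qed

lemma poll_point_evaluated:
  assumes "dmulti_mads_run v P A V0 r" "unsuccessful v P r k" "icenter r k = Some x" "d \<in> idirs r k"
    and "x + mesh_size r k *\<^sub>R d \<in> ground P"
  shows "x + mesh_size r k *\<^sub>R d \<in> evald r (Suc k)"
  using iteration_of_run[OF assms(1), of k] assms(2-) by (auto simp: iteration_def poll_points_def)

lemma poll_step_le:
  assumes "dmulti_mads_run v P A V0 r" "icenter r k = Some x" "d \<in> idirs r k"
  shows "mesh_size r k * norm d \<le> bconst A * frame r k"
  using iteration_of_run[OF assms(1), of k] assms(2-) by (simp add: iteration_def admissible_dirs_def)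

lemma mesh_size_pos:
  assumes "dmulti_mads_run v P A V0 r"
  shows "0 < mesh_size r k"
proof -
  have "0 < frame r k" using assms by (simp add: dmulti_mads_run_def)
  then show ?thesis by (simp add: mesh_size_def)
qed

text \<open>By continuity, values near \<open>xhat\<close> differ from the value there by less than
  its modulus, hence cannot vanish.\<close>

lemma violation_pos_near:
  assumes "lipschitz_near (ground P) (violation P) xhat" "xhat \<in> ground P" "violation P xhat \<noteq> 0"
  obtains e where "0 < e" "\<And>y. y \<in> ground P \<Longrightarrow> dist y xhat < e \<Longrightarrow> 0 < violation P y"
proof -
  obtain \<rho> L where \<rho>: "0 < \<rho>" and fin: "\<And>y. y \<in> ground P \<inter> ball xhat \<rho> \<Longrightarrow> \<bar>violation P y\<bar> \<noteq> \<infinity>"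
    and L: "L-lipschitz_on (ground P \<inter> ball xhat \<rho>) (\<lambda>y. real_of_ereal (violation P y))"
    using assms(1) unfolding lipschitz_near_def by auto
  have x: "xhat \<in> ground P \<inter> ball xhat \<rho>" using assms(2) \<rho> by simp
  have "real_of_ereal (violation P xhat) \<noteq> 0"
    using fin[OF x] assms(3) by (auto simp: real_of_ereal_eq_0)
  then obtain e where e: "0 < e"
    "\<And>y. y \<in> ground P \<inter> ball xhat \<rho> \<Longrightarrow> dist y xhat < e \<Longrightarrow>
      dist (real_of_ereal (violation P y)) (real_of_ereal (violation P xhat)) < \<bar>real_of_ereal (violation P xhat)\<bar>"
    using lipschitz_on_continuous_on[OF L] x unfolding continuous_on_iff
    by (metis zero_less_abs_iff)
  show thesis
  proof
    show "0 < min e \<rho>" using e(1) \<rho> by simp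
    fix y assume "y \<in> ground P" "dist y xhat < min e \<rho>"
    then have "violation P y \<noteq> 0" using e(2)[of y] by (auto simp: dist_commute)
    then show "0 < violation P y" using violation_nonneg[of P y] by (simp add: less_le)
  qed
qed

section \<open>Clarke tangent cones\<close>

lemma clarke_tangent_coneD:
  assumes "d \<in> clarke_tangent_cone X x" "\<And>k. y k \<in> X" "y \<longlonglongrightarrow> x" "\<And>k. 0 < t k" "t \<longlonglongrightarrow> 0"
  shows "\<exists>w. w \<longlonglongrightarrow> d \<and> (\<forall>k. y k + t k *\<^sub>R w k \<in> X)"
  using assms by (simp add: clarke_tangent_cone_def)

text \<open>The factor \<open>c\<close> moves from the direction to the step sizes, as
  \<open>t * c\<close> is again an admissible null sequence. This reduces a nonzero tangent vector
  to a unit one, the only kind the density hypothesis speaks of.\<close>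

lemma clarke_tangent_cone_scaleR:
  assumes d: "d \<in> clarke_tangent_cone X x" and c: "0 < c"
  shows "c *\<^sub>R d \<in> clarke_tangent_cone X x"
  unfolding clarke_tangent_cone_def
proof (intro CollectI allI impI)
  fix y :: "nat \<Rightarrow> 'a" and t :: "nat \<Rightarrow> real"
  assume y: "\<forall>k. y k \<in> X" "y \<longlonglongrightarrow> x" and t: "\<forall>k. 0 < t k" "t \<longlonglongrightarrow> 0"
  have "\<forall>k. 0 < t k * c" "(\<lambda>k. t k * c) \<longlonglongrightarrow> 0"
    using t c tendsto_mult_left_zero[OF t(2)] by auto
  then obtain w where w: "w \<longlonglongrightarrow> d" "\<forall>k. y k + (t k * c) *\<^sub>R w k \<in> X"
    using clarke_tangent_coneD[OF d, of y "\<lambda>k. t k * c"] y by auto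
  then show "\<exists>w. w \<longlonglongrightarrow> c *\<^sub>R d \<and> (\<forall>k. y k + t k *\<^sub>R w k \<in> X)"
    by (intro exI[of _ "\<lambda>k. c *\<^sub>R w k"]) (auto intro: tendsto_scaleR)
qed

lemma incumbents_I_subset_evald: "incumbents_I v P r k \<subseteq> evald r k"
  by (auto simp: incumbents_I_def pb_incumbents_def inf_front_def least_violation_def Let_def
      split: variant.splits)

section \<open>Stationarity of the refining point\<close>

theorem theorem5p6:
  fixes P :: "('n::finite, 'm::finite, 'j) problem"
    and A :: "('n, 'd::finite) params"
    and v :: variant
    and V0 :: "(real^'n) set"
    and r :: "'n run"
    and K :: "nat set"
    and xI :: "nat \<Rightarrow> real^'n"
    and xhat :: "real^'n"
  assumes "valid_problem P" and "valid_params A"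
    and "dmulti_mads_run v P A V0 r"
    and "\<exists>x0\<in>V0. x0 \<in> ground P \<and> (\<forall>i. \<bar>obj P i x0\<bar> \<noteq> \<infinity>) \<and> \<bar>violation P x0\<bar> \<noteq> \<infinity>"
    and "bounded (\<Union>k. evald r k)"
    and "infeasible_refining_subsequence v P r K xI xhat"
    and "\<forall>k\<in>K. xI k \<in> incumbents_I v P r k"
    and "xhat \<in> ground P"
    and "lipschitz_near (ground P) (violation P) xhat"
    and "hypertangent_cone (ground P) xhat \<noteq> {}"
    and "\<forall>u\<in>clarke_tangent_cone (ground P) xhat.
           norm u = 1 \<longrightarrow> u \<in> closure (infeasible_refining_directions P r K xI)"
  shows "clarke_stationary (ground P) (violation P) xhat"
  unfolding clarke_stationary_def
proof
  fix d assume d: "d \<in> clarke_tangent_cone (ground P) xhat"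
  let ?X = "ground P" and ?h = "violation P"
  note run = assms(3)
  have K: "\<And>k. k \<in> K \<Longrightarrow> unsuccessful v P r k" "\<And>k. k \<in> K \<Longrightarrow> icenter r k = Some (xI k)"
    and frame0: "(frame r \<longlongrightarrow> 0) (along K)" and xlim: "(xI \<longlongrightarrow> xhat) (along K)"
    using assms(6) by (auto simp: infeasible_refining_subsequence_def)
  show "0 \<le> clarke_jahn_derivative ?X ?h xhat d"
  proof (rule clarke_jahn_derivative_nonneg[OF assms(9,10)])
    fix e :: real assume e: "0 < e"
    consider "d = 0" | "?h xhat = 0" | "d \<noteq> 0" "?h xhat \<noteq> 0" by blast
    then show "\<exists>x t w. x \<in> ?X \<and> dist x xhat < e \<and> 0 < t \<and> t < e \<and> dist w d < e \<and>
      x + t *\<^sub>R w \<in> ?X \<and> ?h x \<le> ?h (x + t *\<^sub>R w)"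
    proof cases
      case 1
      then show ?thesis
        using e assms(8) by (intro exI[of _ xhat] exI[of _ "e / 2"] exI[of _ 0]) simp
    next
      case 2
      \<comment> \<open>Any positive null sequence serves here: tangency with constant base point
        \<open>xhat\<close> yields steps inside the ground set, and no value is below
        \<open>?h xhat = 0\<close>.\<close>
      define t where "t = (\<lambda>k. 1 / real (Suc k))"
      have t: "t \<longlonglongrightarrow> 0" unfolding t_def by (rule LIMSEQ_Suc[OF lim_1_over_n])
      moreover have tpos: "0 < t k" for k by (simp add: t_def)
      ultimately obtain w where w: "w \<longlonglongrightarrow> d" "\<And>k. xhat + t k *\<^sub>R w k \<in> ?X"
        using clarke_tangent_coneD[OF d, of "\<lambda>_. xhat" t] assms(8) by auto
      have "\<forall>\<^sub>F k in sequentially. dist (w k) d < e \<and> t k < e"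
        using tendstoD[OF w(1) e] order_tendstoD(2)[OF t e] by eventually_elim simp
      then obtain k where "dist (w k) d < e" "t k < e" by (auto simp: eventually_sequentially)
      then show ?thesis
        using 2 w(2)[of k] tpos[of k] assms(8) e violation_nonneg
        by (intro exI[of _ xhat] exI[of _ "t k"] exI[of _ "w k"]) simp
    next
      case 3
      define N where "N = norm d"
      have N: "0 < N" using 3 by (simp add: N_def)
      obtain \<rho> where \<rho>: "0 < \<rho>" "\<And>y. y \<in> ?X \<Longrightarrow> dist y xhat < \<rho> \<Longrightarrow> 0 < ?h y"
        using violation_pos_near[OF assms(9,8) 3(2)] by blast
      have "d /\<^sub>R N \<in> clarke_tangent_cone ?X xhat"
        using d N by (intro clarke_tangent_cone_scaleR) auto
      then have "d /\<^sub>R N \<in> closure (infeasible_refining_directions P r K xI)"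
        using assms(11) N by (simp add: N_def)
      \<comment> \<open>Half of the error \<open>e / N\<close> for unit vectors is spent here, half
        on approximating \<open>u\<close> by a normalized poll direction; scaling by
        \<open>N\<close> turns the total into \<open>e\<close>.\<close>
      then obtain u where u: "u \<in> infeasible_refining_directions P r K xI" "dist u (d /\<^sub>R N) < e / (2 * N)"
        using e N by (metis closure_approachable divide_pos_pos mult_pos_pos zero_less_numeral)
      then obtain K' D where K': "K' \<subseteq> K" "infinite K'"
        and D: "\<And>k. k \<in> K' \<Longrightarrow> D k \<in> idirs r k" "\<And>k. k \<in> K' \<Longrightarrow> D k \<noteq> 0"
          "\<And>k. k \<in> K' \<Longrightarrow> xI k + mesh_size r k *\<^sub>R D k \<in> ?X"
        and Dlim: "((\<lambda>k. D k /\<^sub>R norm (D k)) \<longlongrightarrow> u) (along K')"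
        unfolding infeasible_refining_directions_def by blast
      have le: "along K' \<le> along K" using K'(1) by (intro inf_mono) auto
      have ne: "along K' \<noteq> bot"
        using K'(2) by (simp add: trivial_limit_def eventually_inf_principal eventually_sequentially)
          (metis infinite_nat_iff_unbounded_le)
      have inK': "\<forall>\<^sub>F k in along K'. k \<in> K'" by (simp add: eventually_inf_principal)
      \<comment> \<open>\<open>\<sigma> k\<close> is the length of the poll step; it is at most
        \<open>bconst A * frame r k\<close>, which tends to 0 along \<open>K'\<close>.\<close>
      define \<sigma> where "\<sigma> = (\<lambda>k. mesh_size r k * norm (D k))"
      have bound0: "((\<lambda>k. bconst A * frame r k) \<longlongrightarrow> 0) (along K')"
        using tendsto_mult_right_zero[OF tendsto_mono[OF le frame0]] by simp
      have x': "(xI \<longlongrightarrow> xhat) (along K')" using tendsto_mono[OF le xlim] .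
      \<comment> \<open>\<open>\<rho> / 2\<close> bounds both the distance of the center from
        \<open>xhat\<close> and the poll step, so the poll point stays within \<open>\<rho>\<close>.
        The bound \<open>e * N\<close> serves the rescaled step size
        \<open>\<sigma> k / N\<close>.\<close>
      define \<eta> where "\<eta> = Min {\<rho> / 2, e, e * N}"
      have \<eta>: "0 < \<eta>" "\<eta> \<le> \<rho> / 2" "\<eta> \<le> e" "\<eta> \<le> e * N" using \<rho> e N by (auto simp: \<eta>_def)
      have "\<forall>\<^sub>F k in along K'. k \<in> K' \<and> bconst A * frame r k < \<eta> \<and> dist (xI k) xhat < \<eta> \<and>
          dist (D k /\<^sub>R norm (D k)) u < e / (2 * N)"
        using inK' order_tendstoD(2)[OF bound0 \<eta>(1)] tendstoD[OF x' \<eta>(1)] tendstoD[OF Dlim, of "e / (2 * N)"] e N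
        by (simp add: eventually_conj_iff)
      then obtain k where k: "k \<in> K'" "bconst A * frame r k < \<eta>" "dist (xI k) xhat < \<eta>"
          "dist (D k /\<^sub>R norm (D k)) u < e / (2 * N)"
        using ne eventually_happens by blast
      have kK: "k \<in> K" using k K' by blast
      define y where "y = xI k + mesh_size r k *\<^sub>R D k"
      define w where "w = D k /\<^sub>R norm (D k)"
      have \<sigma>: "0 < \<sigma> k" "\<sigma> k < \<eta>"
        using mesh_size_pos[OF run] D(2)[OF k(1)] poll_step_le[OF run K(2)[OF kK] D(1)[OF k(1)]] k(2)
        by (auto simp: \<sigma>_def)
      \<comment> \<open>The poll displacement is rewritten with direction
        \<open>N *\<^sub>R w\<close>, which approximates \<open>d\<close> itself rather than its
        normalization.\<close>
      have ystep: "xI k + (\<sigma> k / N) *\<^sub>R (N *\<^sub>R w) = y"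
        using N D(2)[OF k(1)] by (simp add: y_def \<sigma>_def w_def)
      have yX: "y \<in> ?X" using D(3)[OF k(1)] by (simp add: y_def)
      have "dist y xhat \<le> \<sigma> k + dist (xI k) xhat"
        using norm_triangle_ineq[of "mesh_size r k *\<^sub>R D k" "xI k - xhat"] mesh_size_pos[OF run, of k]
        by (simp add: y_def \<sigma>_def dist_norm algebra_simps)
      \<comment> \<open>Positivity rules out a feasible poll point, about which the comparison with
        the infeasible center says nothing.\<close>
      then have "0 < ?h y" using \<rho>(2) yX \<sigma>(2) k(3) \<eta>(2) by simp
      then have "?h (xI k) \<le> ?h y"
        using violation_ge_infeasible_center[OF run K(1)[OF kK] K(2)[OF kK]] assms(7) kK
          poll_point_evaluated[OF run K(1)[OF kK] K(2)[OF kK] D(1)[OF k(1)] D(3)[OF k(1)]]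
        by (simp add: y_def)
      moreover have "xI k \<in> ?X"
        using incumbents_I_subset_evald evald_subset_ground[OF run] assms(7) kK by blast
      moreover have "dist (N *\<^sub>R w) d < e"
      proof -
        have "dist w (d /\<^sub>R N) < e / N"
          using dist_triangle_half_l[of w u "e / N" "d /\<^sub>R N"] k(4) u(2)
          by (simp add: w_def dist_commute)
        moreover have "N *\<^sub>R w - d = N *\<^sub>R (w - d /\<^sub>R N)" using N by (simp add: algebra_simps)
        then have "norm (N *\<^sub>R w - d) = N * norm (w - d /\<^sub>R N)" using N by simp
        ultimately show ?thesis using N by (simp add: dist_norm pos_less_divide_eq mult.commute)
      qed
      moreover have "\<sigma> k / N < e" using \<sigma>(2) \<eta>(4) N by (simp add: field_simps)
      ultimately show ?thesis
        using \<sigma>(1) N k(3) \<eta>(3) yX ystep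
        by (intro exI[of _ "xI k"] exI[of _ "\<sigma> k / N"] exI[of _ "N *\<^sub>R w"]) simp
    qed
  qed
qed

end
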